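(* Let $G$ be an infinite countable discrete amenable group, let $m\ge2$ be an integer, and let $X\subset\{1,\dots,m\}^G$ be a shift of finite type with positive topological entropy. Then its homoclinic equivalence relation $H_X$ is non-trivial.
   Context: $G$ is amenable if there is a sequence $\{F_n\}$ of nonempty finite subsets of $G$ (a Følner sequence) with $|gF_n\Delta F_n|/|F_n|\to0$ for every $g\in G$. $G$ acts on the compact metrizable space $\{1,\dots,m\}^G$ (product topology) by $g'(x_g:g\in G)=(x_{gg'}:g\in G)$. A sub-shift is a nonempty closed subset $X\subset\{1,\dots,m\}^G$ with $gX=X$ for all $g\in G$. A sub-shift $X$ is a shift of finite type if there are a nonempty finite $F\subset G$ and a set $X_F\subset\{1,\dots,m\}^F$ such that $$X=\{(x_g)_{g\in G}: (x_{gg'})_{g\in F}\in X_F\ \text{for each}\ g'\in G\}.$$ The topological entropy of a sub-shift $X$ is $h_{\mathrm{top}}(G,X)=\lim_{n\to\infty}\frac1{|F_n|}\log|\pi_{F_n}(X)|$, where $\pi_F:\{1,\dots,m\}^G\to\{1,\dots,m\}^F$ is the natural projection and $\{F_n\}$ is a Følner sequence (the limit exists and does not depend on the Følner sequence; it equals the usual topological entropy defined via finite open covers). The homoclinic equivalence relation $H_X$ on $X$: $(x,x')\in H_X$ if and only if there is a finite $F\subset G$ such that $x_g=x'_g$ for all $g\in G\setminus F$. $H_X$ is non-trivial if $(x,x')\in H_X$ for some $x\neq x'$ in $X$. *)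

theory Defs
  imports "HOL-Analysis.Analysis" "HOL-Algebra.Coset"
begin

definition folner_sequence :: "('g, 'b) monoid_scheme \<Rightarrow> (nat \<Rightarrow> 'g set) \<Rightarrow> bool" where
  "folner_sequence G F \<longleftrightarrow>
     (\<forall>n. finite (F n) \<and> F n \<noteq> {} \<and> F n \<subseteq> carrier G) \<and>
     (\<forall>g\<in>carrier G.
        (\<lambda>n. real (card (sym_diff (g <#\<^bsub>G\<^esub> F n) (F n))) / real (card (F n))) \<longlonglongrightarrow> 0)"

definition amenable :: "('g, 'b) monoid_scheme \<Rightarrow> bool" where
  "amenable G \<longleftrightarrow> (\<exists>F. folner_sequence G F)"

(* Points of {1..m}^G are extensional functions: undefined outside the carrier,
   so that they are determined by their coordinates. *)
definition full_shift :: "('g, 'b) monoid_scheme \<Rightarrow> nat \<Rightarrow> ('g \<Rightarrow> nat) set" where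
  "full_shift G m = carrier G \<rightarrow>\<^sub>E {1..m}"

definition full_shift_topology :: "('g, 'b) monoid_scheme \<Rightarrow> nat \<Rightarrow> ('g \<Rightarrow> nat) topology" where
  "full_shift_topology G m = product_topology (\<lambda>_. discrete_topology {1..m}) (carrier G)"

definition shift_action :: "('g, 'b) monoid_scheme \<Rightarrow> 'g \<Rightarrow> ('g \<Rightarrow> nat) \<Rightarrow> ('g \<Rightarrow> nat)" where
  "shift_action G g' x = (\<lambda>g\<in>carrier G. x (g \<otimes>\<^bsub>G\<^esub> g'))"

definition subshift :: "('g, 'b) monoid_scheme \<Rightarrow> nat \<Rightarrow> ('g \<Rightarrow> nat) set \<Rightarrow> bool" where
  "subshift G m X \<longleftrightarrow>
     X \<noteq> {} \<and> closedin (full_shift_topology G m) X \<and>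
     (\<forall>g\<in>carrier G. shift_action G g ` X = X)"

definition shift_of_finite_type :: "('g, 'b) monoid_scheme \<Rightarrow> nat \<Rightarrow> ('g \<Rightarrow> nat) set \<Rightarrow> bool" where
  "shift_of_finite_type G m X \<longleftrightarrow>
     subshift G m X \<and>
     (\<exists>F XF. finite F \<and> F \<noteq> {} \<and> F \<subseteq> carrier G \<and> XF \<subseteq> F \<rightarrow>\<^sub>E {1..m} \<and>
        X = {x \<in> full_shift G m. \<forall>g'\<in>carrier G. (\<lambda>g\<in>F. x (g \<otimes>\<^bsub>G\<^esub> g')) \<in> XF})"

(* The number of F-patterns of X is the cardinality of its image under the projection
   {1..m}^G -> {1..m}^F, which is restriction to F.  For amenable G and a sub-shift X the
   limit exists and is the same along every Folner sequence, so the description denotes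
   that common limit. *)
definition topological_entropy :: "('g, 'b) monoid_scheme \<Rightarrow> ('g \<Rightarrow> nat) set \<Rightarrow> real" where
  "topological_entropy G X =
     (THE h. \<forall>F. folner_sequence G F \<longrightarrow>
        (\<lambda>n. ln (real (card ((\<lambda>x. restrict x (F n)) ` X))) / real (card (F n))) \<longlonglongrightarrow> h)"

definition homoclinic_relation ::
    "('g, 'b) monoid_scheme \<Rightarrow> ('g \<Rightarrow> nat) set \<Rightarrow> (('g \<Rightarrow> nat) \<times> ('g \<Rightarrow> nat)) set" where
  "homoclinic_relation G X =
     {(x, x'). x \<in> X \<and> x' \<in> X \<and>
        (\<exists>F. finite F \<and> F \<subseteq> carrier G \<and> (\<forall>g\<in>carrier G - F. x g = x' g))}"

definition nontrivial_on :: "'a set \<Rightarrow> ('a \<times> 'a) set \<Rightarrow> bool" where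
  "nontrivial_on X R \<longleftrightarrow> (\<exists>x\<in>X. \<exists>x'\<in>X. x \<noteq> x' \<and> (x, x') \<in> R)"

end

(* If all homoclinic pairs are trivial, then a point x of X is determined on a finite set A by its
   values on the boundary of A, the part of A met by windows that stick out of A: when x and x'
   agree there, overwriting x' by x on A gives a point of X homoclinic to x', hence x' itself.
   So X has at most m^|boundary of A| patterns on A.  The boundary of a Folner set has vanishing
   relative size, so the entropy is 0 along every Folner sequence; in particular the limit
   defining the entropy exists without an appeal to the Ornstein-Weiss theorem. *)
theory Submission
  imports Defs
begin

text \<open>Inner boundary of \<open>A\<close>. The action shifts on the right, so the windows are
  right translates \<open>F g'\<close>, and points of one window differ by left multiplication; this
  is why \<open>K\<close> acts from the left, as in the Folner condition.\<close>

definition left_boundary :: "('g, 'b) monoid_scheme \<Rightarrow> 'g set \<Rightarrow> 'g set \<Rightarrow> 'g set" where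
  "left_boundary G K A = {h \<in> A. \<exists>k\<in>K. k \<otimes>\<^bsub>G\<^esub> h \<notin> A}"

text \<open>For each \<open>k\<close>, left multiplication by \<open>k\<close> is injective and
  sends the points of \<open>A\<close> that leave \<open>A\<close> under \<open>k\<close> into
  \<open>kA - A\<close>.\<close>

lemma (in group) card_left_boundary_le:
  assumes A: "finite A" "A \<subseteq> carrier G" and K: "finite K" "K \<subseteq> carrier G"
  shows "card (left_boundary G K A) \<le> (\<Sum>k\<in>K. card (sym_diff (k <#\<^bsub>G\<^esub> A) A))"
proof -
  have "left_boundary G K A = (\<Union>k\<in>K. {h \<in> A. k \<otimes> h \<notin> A})"
    by (auto simp: left_boundary_def)
  then have "card (left_boundary G K A) \<le> (\<Sum>k\<in>K. card {h \<in> A. k \<otimes> h \<notin> A})"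
    using card_UN_le[OF K(1)] by simp
  also have "\<dots> \<le> (\<Sum>k\<in>K. card (sym_diff (k <#\<^bsub>G\<^esub> A) A))"
  proof (rule sum_mono)
    fix k assume k: "k \<in> K"
    have "finite (k <#\<^bsub>G\<^esub> A)"
      using A(1) by (simp add: l_coset_def)
    then have fin: "finite (sym_diff (k <#\<^bsub>G\<^esub> A) A)"
      using A(1) by blast
    have inj: "inj_on (\<lambda>h. k \<otimes> h) {h \<in> A. k \<otimes> h \<notin> A}"
      using k K(2) A(2) by (intro inj_onI) (simp add: subset_iff)
    have sub: "(\<lambda>h. k \<otimes> h) ` {h \<in> A. k \<otimes> h \<notin> A} \<subseteq> sym_diff (k <#\<^bsub>G\<^esub> A) A"
      by (auto simp: l_coset_def)
    show "card {h \<in> A. k \<otimes> h \<notin> A} \<le> card (sym_diff (k <#\<^bsub>G\<^esub> A) A)"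
      by (rule card_inj_on_le[OF inj sub fin])
  qed
  finally show ?thesis .
qed

lemma (in group) folner_left_boundary:
  assumes Fo: "folner_sequence G A" and K: "finite K" "K \<subseteq> carrier G"
  shows "(\<lambda>n. real (card (left_boundary G K (A n))) / real (card (A n))) \<longlonglongrightarrow> 0"
proof (rule tendsto_sandwich[OF _ _ tendsto_const])
  show "(\<lambda>n. \<Sum>k\<in>K. real (card (sym_diff (k <#\<^bsub>G\<^esub> A n) (A n))) / real (card (A n))) \<longlonglongrightarrow> 0"
    by (rule tendsto_null_sum) (use Fo K in \<open>auto simp: folner_sequence_def\<close>)
  show "\<forall>\<^sub>F n in sequentially. real (card (left_boundary G K (A n))) / real (card (A n))
      \<le> (\<Sum>k\<in>K. real (card (sym_diff (k <#\<^bsub>G\<^esub> A n) (A n))) / real (card (A n)))"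
  proof (rule always_eventually, rule allI)
    fix n
    have "finite (A n)" "A n \<subseteq> carrier G"
      using Fo by (auto simp: folner_sequence_def)
    then have "real (card (left_boundary G K (A n)))
        \<le> real (\<Sum>k\<in>K. card (sym_diff (k <#\<^bsub>G\<^esub> A n) (A n)))"
      by (intro of_nat_mono card_left_boundary_le K)
    then show "real (card (left_boundary G K (A n))) / real (card (A n))
        \<le> (\<Sum>k\<in>K. real (card (sym_diff (k <#\<^bsub>G\<^esub> A n) (A n))) / real (card (A n)))"
      by (simp add: sum_divide_distrib[symmetric] divide_right_mono)
  qed
qed simp

text \<open>Amenability supplies one Folner sequence, and uniqueness of limits along it makes
  \<open>h\<close> the only number fitting the definite description; with no Folner sequence every
  number would fit vacuously.\<close>

lemma topological_entropy_eqI: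
  assumes "amenable G"
    and lim: "\<And>A. folner_sequence G A \<Longrightarrow>
      (\<lambda>n. ln (real (card ((\<lambda>x. restrict x (A n)) ` X))) / real (card (A n))) \<longlonglongrightarrow> h"
  shows "topological_entropy G X = h"
proof -
  obtain A where A: "folner_sequence G A"
    using assms(1) unfolding amenable_def by blast
  show ?thesis
    unfolding topological_entropy_def
  proof (rule the_equality)
    fix h'
    assume "\<forall>A. folner_sequence G A \<longrightarrow>
      (\<lambda>n. ln (real (card ((\<lambda>x. restrict x (A n)) ` X))) / real (card (A n))) \<longlonglongrightarrow> h'"
    then show "h' = h"
      using LIMSEQ_unique[OF _ lim[OF A]] A by blast
  qed (use lim in blast)
qed

text \<open>By \<open>det\<close> the pattern on \<open>A\<close> is a function of the pattern on
  \<open>D\<close>, and there are at most \<open>m ^ card D\<close> of the latter.\<close>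

lemma card_patterns_le:
  assumes fin: "finite A" "finite D" and X: "\<And>x h. x \<in> X \<Longrightarrow> h \<in> D \<Longrightarrow> x h \<in> {1..m}"
    and det: "\<And>x x'. x \<in> X \<Longrightarrow> x' \<in> X \<Longrightarrow> (\<forall>h\<in>D. x h = x' h) \<Longrightarrow> (\<forall>h\<in>A. x h = x' h)"
  shows "finite ((\<lambda>x. restrict x A) ` X)" "card ((\<lambda>x. restrict x A) ` X) \<le> m ^ card D"
proof -
  let ?P = "(\<lambda>x. restrict x D) ` X"
  have sub: "?P \<subseteq> D \<rightarrow>\<^sub>E {1..m}"
    using X by (intro image_subsetI) (simp add: PiE_iff)
  have finE: "finite (D \<rightarrow>\<^sub>E {1..m})"
    using fin by (auto intro: finite_PiE)
  \<comment> \<open>\<open>r\<close> chooses a point of \<open>X\<close> with a prescribed pattern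
    on \<open>D\<close>; by \<open>det\<close> the choice does not affect its pattern on
    \<open>A\<close>.\<close>
  define r where "r = inv_into X (\<lambda>x. restrict x D)"
  have r: "r (restrict x D) \<in> X" "restrict (r (restrict x D)) D = restrict x D" if "x \<in> X" for x
    using that f_inv_into_f[of "restrict x D" "\<lambda>x. restrict x D" X]
    unfolding r_def by (auto intro: inv_into_into)
  have "restrict x A = restrict (r (restrict x D)) A" if "x \<in> X" for x
  proof (rule restrict_ext)
    have "\<forall>h\<in>D. x h = r (restrict x D) h"
      using r(2)[OF that] by (metis restrict_apply')
    then show "x h = r (restrict x D) h" if "h \<in> A" for h
      using det[OF \<open>x \<in> X\<close> r(1)[OF \<open>x \<in> X\<close>]] that by blast
  qed
  then have im: "(\<lambda>x. restrict x A) ` X \<subseteq> (\<lambda>p. restrict (r p) A) ` ?P"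
    by blast
  have finP: "finite ?P"
    using sub finE finite_subset by blast
  then show "finite ((\<lambda>x. restrict x A) ` X)"
    using im finite_subset by blast
  have "card ((\<lambda>x. restrict x A) ` X) \<le> card ?P"
    using finP im by (meson card_image_le card_mono finite_imageI order_trans)
  also have "\<dots> \<le> card (D \<rightarrow>\<^sub>E {1..m})"
    using sub finE by (rule card_mono[rotated])
  also have "\<dots> = m ^ card D"
    using fin by (simp add: card_PiE)
  finally show "card ((\<lambda>x. restrict x A) ` X) \<le> m ^ card D" .
qed

text \<open>A window inside \<open>A\<close> sees only \<open>x\<close>. A window that sticks out of
  \<open>A\<close> meets \<open>A\<close> only in boundary points, where \<open>x\<close> and
  \<open>x'\<close> agree, so it sees only \<open>x'\<close>. Either way its pattern is
  allowed.\<close>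

lemma (in group) splice_in_finite_type:
  assumes F: "F \<subseteq> carrier G" and A: "A \<subseteq> carrier G"
    and X: "X = {x \<in> full_shift G m. \<forall>g'\<in>carrier G. (\<lambda>g\<in>F. x (g \<otimes> g')) \<in> XF}"
    and x: "x \<in> X" "x' \<in> X"
    and agree: "\<forall>h\<in>left_boundary G {f' \<otimes> inv f | f f'. f \<in> F \<and> f' \<in> F} A. x h = x' h"
  shows "(\<lambda>g. if g \<in> A then x g else x' g) \<in> X"
proof -
  let ?y = "\<lambda>g. if g \<in> A then x g else x' g"
  \<comment> \<open>Since \<open>A\<close> lies in the carrier, the spliced function is
    \<open>undefined\<close> off the carrier, as \<open>x'\<close> is.\<close>
  have "?y \<in> full_shift G m"
    using x A unfolding X full_shift_def by (auto simp: PiE_iff extensional_def)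
  moreover have "(\<lambda>g\<in>F. ?y (g \<otimes> g')) \<in> XF" if g': "g' \<in> carrier G" for g'
  proof (cases "\<forall>f\<in>F. f \<otimes> g' \<in> A")
    case True
    then have "(\<lambda>g\<in>F. ?y (g \<otimes> g')) = (\<lambda>g\<in>F. x (g \<otimes> g'))"
      by (auto intro: restrict_ext)
    then show ?thesis
      using x(1) g' X by auto
  next
    case False
    then obtain f' where f': "f' \<in> F" "f' \<otimes> g' \<notin> A"
      by blast
    have "x (f \<otimes> g') = x' (f \<otimes> g')" if f: "f \<in> F" "f \<otimes> g' \<in> A" for f
    proof -
      have car: "f \<in> carrier G" "f' \<in> carrier G"
        using f f' F by auto
      \<comment> \<open>The element \<open>f' \<otimes> inv f\<close> moves the window point in
        \<open>A\<close> to the one outside, which puts the former in the boundary.\<close>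
      then have "(f' \<otimes> inv f) \<otimes> (f \<otimes> g') = f' \<otimes> g'"
        using g' by (simp add: m_assoc inv_solve_left')
      then show ?thesis
        using agree f f' unfolding left_boundary_def by fastforce
    qed
    then have "(\<lambda>g\<in>F. ?y (g \<otimes> g')) = (\<lambda>g\<in>F. x' (g \<otimes> g'))"
      by (intro restrict_ext) auto
    then show ?thesis
      using x(2) g' X by auto
  qed
  ultimately show ?thesis
    unfolding X by blast
qed

lemma (in group) entropy_zero_if_homoclinic_trivial:
  assumes am: "amenable G" and sft: "shift_of_finite_type G m X"
    and triv: "\<not> nontrivial_on X (homoclinic_relation G X)"
  shows "topological_entropy G X = 0"
proof (rule topological_entropy_eqI[OF am])
  fix A assume Fo: "folner_sequence G A"
  obtain F XF where F: "finite F" "F \<subseteq> carrier G"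
    and X: "X = {x \<in> full_shift G m. \<forall>g'\<in>carrier G. (\<lambda>g\<in>F. x (g \<otimes> g')) \<in> XF}"
    using sft unfolding shift_of_finite_type_def by blast
  have "X \<noteq> {}"
    using sft by (simp add: shift_of_finite_type_def subshift_def)
  \<comment> \<open>These are the quotients carrying one point of a window to another; there are
    finitely many, so the Folner condition controls the boundary they define.\<close>
  define K where "K = {f' \<otimes> inv f | f f'. f \<in> F \<and> f' \<in> F}"
  have "K = (\<lambda>(f, f'). f' \<otimes> inv f) ` (F \<times> F)"
    by (auto simp: K_def)
  then have K: "finite K" "K \<subseteq> carrier G"
    using F by auto
  let ?N = "\<lambda>n. card ((\<lambda>x. restrict x (A n)) ` X)"
  let ?D = "\<lambda>n. left_boundary G K (A n)"
  have N: "?N n > 0" "?N n \<le> m ^ card (?D n)" for n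
  proof -
    have A: "finite (A n)" "A n \<subseteq> carrier G"
      using Fo by (auto simp: folner_sequence_def)
    have D: "?D n \<subseteq> A n"
      by (auto simp: left_boundary_def)
    have det: "\<forall>h\<in>A n. x h = x' h"
      if x: "x \<in> X" "x' \<in> X" and agree: "\<forall>h\<in>?D n. x h = x' h" for x x'
    proof -
      let ?y = "\<lambda>g. if g \<in> A n then x g else x' g"
      have "?y \<in> X"
        by (rule splice_in_finite_type[OF F(2) A(2) X x agree[unfolded K_def]])
      moreover have "(?y, x') \<in> homoclinic_relation G X"
        using \<open>?y \<in> X\<close> x A unfolding homoclinic_relation_def by auto
      ultimately have "?y = x'"
        using triv x unfolding nontrivial_on_def by blast
      \<comment> \<open>On \<open>A n\<close> the spliced point takes the values of
        \<open>x\<close>, so its equality with \<open>x'\<close> is the agreement wanted.\<close>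
      from fun_cong[OF this] show ?thesis
        by metis
    qed
    have vals: "x h \<in> {1..m}" if "x \<in> X" "h \<in> ?D n" for x h
    proof -
      have "x \<in> carrier G \<rightarrow>\<^sub>E {1..m}" "h \<in> carrier G"
        using that D A(2) X unfolding full_shift_def by auto
      then show ?thesis
        by (rule PiE_mem)
    qed
    have finD: "finite (?D n)"
      using D A(1) finite_subset by blast
    show "?N n \<le> m ^ card (?D n)"
      by (rule card_patterns_le(2)[OF A(1) finD], erule (1) vals, erule (2) det)
    \<comment> \<open>Positivity of \<open>card\<close> includes finiteness, as an infinite set has
      \<open>card\<close> 0.\<close>
    have "finite ((\<lambda>x. restrict x (A n)) ` X)"
      by (rule card_patterns_le(1)[where m = m, OF A(1) finD], erule (1) vals, erule (2) det)
    then show "?N n > 0"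
      unfolding card_gt_0_iff using \<open>X \<noteq> {}\<close> by blast
  qed
  \<comment> \<open>A point of \<open>X\<close> has a symbol at the identity, so the alphabet is
    nonempty; positivity of \<open>m\<close> lets the logarithm of \<open>m ^ card (?D n)\<close> be
    expanded.\<close>
  obtain x where "x \<in> full_shift G m"
    using \<open>X \<noteq> {}\<close> X by blast
  then have "x \<one> \<in> {1..m}"
    unfolding full_shift_def by (rule PiE_mem) simp
  then have m: "m > 0"
    by simp
  show "(\<lambda>n. ln (real (?N n)) / real (card (A n))) \<longlonglongrightarrow> 0"
  proof (rule tendsto_sandwich[OF _ _ tendsto_const])
    show "(\<lambda>n. ln (real m) * (real (card (?D n)) / real (card (A n)))) \<longlonglongrightarrow> 0"
      by (rule tendsto_mult_right_zero[OF folner_left_boundary[OF Fo K]])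
    show "\<forall>\<^sub>F n in sequentially. ln (real (?N n)) / real (card (A n))
        \<le> ln (real m) * (real (card (?D n)) / real (card (A n)))"
    proof (rule always_eventually, rule allI)
      fix n
      have "real (?N n) \<le> real m ^ card (?D n)"
        using N(2)[of n] by (metis of_nat_mono of_nat_power)
      then have "ln (real (?N n)) \<le> ln (real m ^ card (?D n))"
        using N(1)[of n] m by (subst ln_le_cancel_iff) auto
      also have "\<dots> = ln (real m) * real (card (?D n))"
        using m by (simp add: ln_realpow)
      finally show "ln (real (?N n)) / real (card (A n))
          \<le> ln (real m) * (real (card (?D n)) / real (card (A n)))"
        by (simp add: divide_right_mono)
    qed
    \<comment> \<open>At least one pattern occurs, so the logarithm is nonnegative.\<close>
    show "\<forall>\<^sub>F n in sequentially. 0 \<le> ln (real (?N n)) / real (card (A n))"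
      using N(1) by (intro always_eventually allI divide_nonneg_nonneg ln_ge_zero)
        (auto simp: Suc_le_eq)
  qed
qed

theorem proposition4p1:
  fixes G :: "('g, 'b) monoid_scheme" and m :: nat and X :: "('g \<Rightarrow> nat) set"
  assumes "group G" and "infinite (carrier G)" and "countable (carrier G)"
    and "amenable G"
    and "m \<ge> 2"
    and "shift_of_finite_type G m X"
    and "topological_entropy G X > 0"
  shows "nontrivial_on X (homoclinic_relation G X)"
  using group.entropy_zero_if_homoclinic_trivial[OF assms(1,4,6)] assms(7) by auto

end
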